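(* Let $\mathcal{H}$ be an infinite dimensional Hilbert space. Assume that $f:[B(\mathcal{H})^n]_1^-\to B(\mathcal{H})$ is a continuous function in the operator norm, and it is free holomorphic on $[B(\mathcal{H})^n]_1$. Then $$\max\{\|f(X_1,\ldots,X_n)\|:\ \|[X_1,\ldots,X_n]\|\le1\}=\max\{\|f(X_1,\ldots,X_n)\|:\ \|[X_1,\ldots,X_n]\|=1\}.$$
   Context: $\|[X_1,\ldots,X_n]\|:=\|X_1X_1^*+\cdots+X_nX_n^*\|^{1/2}$ for $[X_1,\ldots,X_n]\in B(\mathcal{H})^n$; $[B(\mathcal{H})^n]_1$ and $[B(\mathcal{H})^n]_1^-$ are the corresponding open and closed unit balls. $\mathbb{F}_n^+$ is the unital free semigroup on generators $g_1,\ldots,g_n$ with identity $g_0$; $|\alpha|$ is word length; $X_\alpha:=X_{i_1}\cdots X_{i_k}$ if $\alpha=g_{i_1}\cdots g_{i_k}$, $X_{g_0}:=I$. A function $f:[B(\mathcal{H})^n]_1\to B(\mathcal{H})$ is free holomorphic (with scalar coefficients) if there exist $a_\alpha\in\mathbb{C}$, $\alpha\in\mathbb{F}_n^+$, with $\limsup_{k\to\infty}(\sum_{|\alpha|=k}|a_\alpha|^2)^{1/2k}\le1$ and $f(X_1,\ldots,X_n)=\sum_{k=0}^\infty\sum_{|\alpha|=k}a_\alpha X_\alpha$ (norm convergence) for all $[X_1,\ldots,X_n]\in[B(\mathcal{H})^n]_1$. *)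

theory Defs
  imports "HOL-Analysis.Analysis"
begin

text \<open>Complex Hilbert spaces. The inner product is linear in its first argument. The real
  structure inherited from \<^class>\<open>banach\<close> is tied to the complex one by \<open>scaleR_scaleC\<close> and
  \<open>norm_eq_sqrt_cinner\<close>.\<close>

class complex_hilbert_space = banach +
  fixes scaleC :: "complex \<Rightarrow> 'a \<Rightarrow> 'a" (infixr \<open>*\<^sub>C\<close> 75)
    and cinner :: "'a \<Rightarrow> 'a \<Rightarrow> complex"
  assumes scaleC_add_right: "c *\<^sub>C (x + y) = c *\<^sub>C x + c *\<^sub>C y"
    and scaleC_add_left: "(c + d) *\<^sub>C x = c *\<^sub>C x + d *\<^sub>C x"
    and scaleC_scaleC: "c *\<^sub>C d *\<^sub>C x = (c * d) *\<^sub>C x"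
    and scaleC_one: "1 *\<^sub>C x = x"
    and scaleR_scaleC: "r *\<^sub>R x = complex_of_real r *\<^sub>C x"
    and cinner_add_left: "cinner (x + y) z = cinner x z + cinner y z"
    and cinner_scaleC_left: "cinner (c *\<^sub>C x) y = c * cinner x y"
    and cinner_commute: "cinner x y = cnj (cinner y x)"
    and cinner_ge_zero: "0 \<le> Re (cinner x x)"
    and cinner_eq_zero_iff: "cinner x x = 0 \<longleftrightarrow> x = 0"
    and norm_eq_sqrt_cinner: "norm x = sqrt (Re (cinner x x))"

global_interpretation complex_vector:
  vector_space "scaleC :: complex \<Rightarrow> 'a \<Rightarrow> 'a::complex_hilbert_space"
  by standard (simp_all add: scaleC_add_right scaleC_add_left scaleC_scaleC scaleC_one)

lemma norm_scaleC: "norm (c *\<^sub>C x) = cmod c * norm x"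
  for x :: "'a::complex_hilbert_space"
proof -
  have "cinner (c *\<^sub>C x) (c *\<^sub>C x) = c * cnj (c * cinner x x)"
    by (metis cinner_commute cinner_scaleC_left)
  also have "\<dots> = of_real ((cmod c)\<^sup>2) * cinner x x"
    by (metis cinner_commute complex_cnj_mult complex_norm_square mult.assoc)
  finally show ?thesis
    by (simp add: norm_eq_sqrt_cinner real_sqrt_mult)
qed

lemma bounded_linear_scaleC: "bounded_linear ((*\<^sub>C) c)"
  for c :: complex
proof (rule bounded_linear_intro)
  show "c *\<^sub>C (r *\<^sub>R x) = r *\<^sub>R (c *\<^sub>C x)" for r and x :: "'a::complex_hilbert_space"
    by (simp add: scaleR_scaleC scaleC_scaleC mult.commute)
  show "norm (c *\<^sub>C x) \<le> norm x * cmod c" for x :: "'a::complex_hilbert_space"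
    by (simp add: norm_scaleC)
qed (simp add: scaleC_add_right)

text \<open>\<open>B(H)\<close> is the set of complex-linear elements of the library type of bounded real-linear
  maps; the norm of that type is the operator norm.\<close>

definition bounded_operators :: "('a::complex_hilbert_space \<Rightarrow>\<^sub>L 'a) set" where
  "bounded_operators =
    {A. \<forall>c x. blinfun_apply A (c *\<^sub>C x) = c *\<^sub>C blinfun_apply A x}"

lift_definition scaleC_blinfun ::
    "complex \<Rightarrow> ('a::complex_hilbert_space \<Rightarrow>\<^sub>L 'a) \<Rightarrow> ('a \<Rightarrow>\<^sub>L 'a)"
  is "\<lambda>c A x. c *\<^sub>C A x"
  by (rule bounded_linear_compose[OF bounded_linear_scaleC])

definition adjoint_op ::
    "('a::complex_hilbert_space \<Rightarrow>\<^sub>L 'a) \<Rightarrow> ('a \<Rightarrow>\<^sub>L 'a)" where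
  "adjoint_op A = (THE B. \<forall>x y. cinner (blinfun_apply A x) y = cinner x (blinfun_apply B y))"

text \<open>\<open>n\<close>-tuples of operators are vectors indexed by a finite type \<open>'n\<close>, with \<open>n = CARD('n)\<close>;
  their topology is the product of the operator norm topologies. The \<open>norm\<close> of the vector type
  is \<^emph>\<open>not\<close> the norm of a tuple used here, which is \<open>row_norm\<close>.\<close>

definition operator_tuples :: "(('a::complex_hilbert_space \<Rightarrow>\<^sub>L 'a) ^ 'n) set" where
  "operator_tuples = {X. \<forall>i. X $ i \<in> bounded_operators}"

definition row_norm :: "('a::complex_hilbert_space \<Rightarrow>\<^sub>L 'a) ^ 'n \<Rightarrow> real" where
  "row_norm X = sqrt (norm (\<Sum>i\<in>UNIV. X $ i o\<^sub>L adjoint_op (X $ i)))"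

definition open_row_ball :: "(('a::complex_hilbert_space \<Rightarrow>\<^sub>L 'a) ^ 'n) set" where
  "open_row_ball = {X \<in> operator_tuples. row_norm X < 1}"

definition closed_row_ball :: "(('a::complex_hilbert_space \<Rightarrow>\<^sub>L 'a) ^ 'n) set" where
  "closed_row_ball = {X \<in> operator_tuples. row_norm X \<le> 1}"

definition row_sphere :: "(('a::complex_hilbert_space \<Rightarrow>\<^sub>L 'a) ^ 'n) set" where
  "row_sphere = {X \<in> operator_tuples. row_norm X = 1}"

text \<open>The free semigroup on \<open>n\<close> generators is \<open>'n list\<close>, with the empty list as identity.\<close>

definition word_op ::
    "('a::complex_hilbert_space \<Rightarrow>\<^sub>L 'a) ^ 'n \<Rightarrow> 'n list \<Rightarrow> ('a \<Rightarrow>\<^sub>L 'a)" where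
  "word_op X \<alpha> = foldr (\<lambda>i A. X $ i o\<^sub>L A) \<alpha> id_blinfun"

text \<open>Only the values of \<open>f\<close> on the open ball matter. The term \<open>k = 0\<close> of the root sequence,
  where \<open>root 0\<close> is a junk value, does not affect the limit superior.\<close>

definition free_holomorphic ::
    "(('a::complex_hilbert_space \<Rightarrow>\<^sub>L 'a) ^ 'n::finite \<Rightarrow> ('a \<Rightarrow>\<^sub>L 'a)) \<Rightarrow> bool" where
  "free_holomorphic f \<longleftrightarrow>
    (\<exists>a :: 'n list \<Rightarrow> complex.
      limsup (\<lambda>k. ereal (root (2 * k) (\<Sum>\<alpha> | length \<alpha> = k. (cmod (a \<alpha>))\<^sup>2))) \<le> 1 \<and>
      (\<forall>X \<in> open_row_ball.
        (\<lambda>k. \<Sum>\<alpha> | length \<alpha> = k. scaleC_blinfun (a \<alpha>) (word_op X \<alpha>)) sums f X))"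

text \<open>The library's \<open>Max\<close> is meaningful for finite sets only.\<close>

definition is_maximum :: "real set \<Rightarrow> real \<Rightarrow> bool" where
  "is_maximum S m \<longleftrightarrow> m \<in> S \<and> (\<forall>x\<in>S. x \<le> m)"

end

theory Submission
  imports Defs
begin

text \<open>The maximum is attained at the tuple of left creation operators. An infinite dimensional
  \<open>H\<close> contains an orthonormal family \<open>e\<close> indexed by words, and the operators \<open>X\<^sub>i\<close> with
  \<open>X\<^sub>i e\<^sub>\<alpha> = e\<^bsub>i\<alpha>\<^esub>\<close> that vanish on the orthogonal complement form a tuple \<open>X\<close> of row norm one.
  By the noncommutative von Neumann inequality \<open>\<parallel>p Z\<parallel> \<le> \<parallel>p X\<parallel>\<close> for polynomials \<open>p\<close> and strict
  row contractions \<open>Z\<close>. Applied to the partial sums of \<open>f\<close> this gives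
  \<open>\<parallel>f (s\<^sup>2 Y)\<parallel> \<le> \<parallel>f (s X)\<parallel>\<close> for \<open>s < 1\<close> and every \<open>Y\<close> in the closed ball, and \<open>s\<close> tends to one.

  For the von Neumann inequality let \<open>T\<^sub>i\<close> be the adjoint of \<open>Z\<^sub>i\<close>. The positive form
  \<open>B x y = \<langle>x, y\<rangle> - (\<Sum>i. \<langle>T\<^sub>i x, T\<^sub>i y\<rangle>)\<close> telescopes along words to
  \<open>\<langle>h, k\<rangle> = (\<Sum>\<alpha>. B (T\<^sub>\<alpha> h) (T\<^sub>\<alpha> k))\<close>, so \<open>\<langle>p Z h, k\<rangle>\<close> is the scalar matrix of \<open>p X\<close> in the
  basis \<open>e\<close> paired with values of \<open>B\<close>. Since Gram matrices are sums of rank one matrices, the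
  bound for scalar vectors carries over to \<open>B\<close>.\<close>

section \<open>Positive sesquilinear forms and the Riesz representation\<close>

lemma mult_cnj_cmod: "z * cnj z = (complex_of_real (cmod z))\<^sup>2"
  by (simp add: complex_norm_square flip: of_real_power)

locale positive_form =
  fixes B :: "'a::complex_hilbert_space \<Rightarrow> 'a \<Rightarrow> complex"
  assumes add_left: "B (x + y) z = B x z + B y z"
    and scaleC_left: "B (c *\<^sub>C x) y = c * B x y"
    and commute: "B x y = cnj (B y x)"
    and ge_zero: "0 \<le> Re (B x x)"
begin

lemma add_right: "B x (y + z) = B x y + B x z"
  by (metis add_left commute complex_cnj_add)

lemma scaleC_right: "B x (c *\<^sub>C y) = cnj c * B x y"
  by (metis scaleC_left commute complex_cnj_mult)

lemma scaleR_left: "B (r *\<^sub>R x) y = of_real r * B x y"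
  by (simp add: scaleR_scaleC scaleC_left)

lemma zero_left [simp]: "B 0 y = 0"
  using add_left[of 0 0 y] by simp

lemma zero_right [simp]: "B y 0 = 0"
  using add_right[of y 0 0] by simp

lemma minus_left: "B (- x) y = - B x y"
  using add_left[of x "- x" y] by (simp add: add_eq_0_iff)

lemma minus_right: "B x (- y) = - B x y"
  using add_right[of x y "- y"] by (simp add: add_eq_0_iff)

lemma diff_left: "B (x - y) z = B x z - B y z"
  using add_left[of x "- y" z] by (simp add: minus_left)

lemma diff_right: "B x (y - z) = B x y - B x z"
  using add_right[of x y "- z"] by (simp add: minus_right)

lemma sum_left: "B (sum f A) y = (\<Sum>i\<in>A. B (f i) y)"
  by (induction A rule: infinite_finite_induct) (auto simp: add_left)

lemma sum_right: "B x (sum f A) = (\<Sum>i\<in>A. B x (f i))"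
  by (induction A rule: infinite_finite_induct) (auto simp: add_right)

lemma self_of_real: "B x x = of_real (Re (B x x))"
  using commute[of x x] by (metis Reals_cnj_iff of_real_Re)

text \<open>For a null vector \<open>y\<close>, subtracting \<open>t * B x y\<close> times
  \<open>y\<close> from \<open>x\<close> makes the value of the form affine in the real
  \<open>t\<close>, with slope \<open>-2 * (cmod (B x y))\<^sup>2\<close>. Nonnegativity for every
  \<open>t\<close> forces the slope to be zero. The case comes first because
  \<open>Cauchy_Schwarz\<close> divides by \<open>B y y\<close>.\<close>

lemma eq_zero_if_self_zero:
  assumes "Re (B y y) = 0"
  shows "B x y = 0"
proof (rule ccontr)
  assume "B x y \<noteq> 0"
  define s where "s = (cmod (B x y))\<^sup>2"
  have s: "s > 0" using \<open>B x y \<noteq> 0\<close> by (simp add: s_def)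
  have yy: "B y y = 0" using assms self_of_real[of y] by simp
  have *: "0 \<le> Re (B x x) - 2 * t * s" for t :: real
  proof -
    let ?c = "of_real t * B x y"
    have "B (x - ?c *\<^sub>C y) (x - ?c *\<^sub>C y) = B x x - ?c * B y x - cnj ?c * B x y"
      by (simp add: diff_left diff_right scaleC_left scaleC_right yy algebra_simps)
    also have "B y x = cnj (B x y)" by (rule commute)
    also have "?c * cnj (B x y) = of_real (t * s)"
      by (simp add: s_def mult.assoc mult_cnj_cmod)
    also have "cnj ?c * B x y = of_real t * (B x y * cnj (B x y))"
      by simp
    also have "\<dots> = of_real (t * s)"
      by (simp add: s_def mult_cnj_cmod)
    finally show ?thesis using ge_zero[of "x - ?c *\<^sub>C y"] by (simp add: mult_ac)
  qed
  \<comment> \<open>This \<open>t\<close> gives the affine expression the value -1.\<close>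
  show False using *[of "(Re (B x x) + 1) / (2 * s)"] s by simp
qed

lemma Cauchy_Schwarz: "(cmod (B x y))\<^sup>2 \<le> Re (B x x) * Re (B y y)"
proof (cases "Re (B y y) = 0")
  case True
  then show ?thesis by (simp add: eq_zero_if_self_zero)
next
  case False
  define b where "b = Re (B y y)"
  have b: "b > 0" using False ge_zero[of y] by (simp add: b_def)
  have yy: "B y y = of_real b" unfolding b_def by (rule self_of_real)
  \<comment> \<open>The coefficient of the \<open>B\<close>-orthogonal projection of
    \<open>x\<close> onto \<open>y\<close>.\<close>
  let ?c = "B x y / of_real b"
  have "B (x - ?c *\<^sub>C y) (x - ?c *\<^sub>C y)
      = B x x - ?c * B y x - cnj ?c * B x y + ?c * cnj ?c * of_real b"
    by (simp add: diff_left diff_right scaleC_left scaleC_right yy algebra_simps)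
  also have "B y x = cnj (B x y)" by (rule commute)
  also have "?c * cnj (B x y) = of_real ((cmod (B x y))\<^sup>2 / b)"
    by (simp add: mult_cnj_cmod)
  also have "cnj ?c * B x y = B x y * cnj (B x y) / of_real b"
    by simp
  also have "\<dots> = of_real ((cmod (B x y))\<^sup>2 / b)"
    by (simp add: mult_cnj_cmod)
  also have "?c * cnj ?c * of_real b = B x y * cnj (B x y) / of_real b"
    using b by simp
  also have "\<dots> = of_real ((cmod (B x y))\<^sup>2 / b)"
    by (simp add: mult_cnj_cmod)
  finally have "0 \<le> Re (B x x) - (cmod (B x y))\<^sup>2 / b"
    using ge_zero[of "x - ?c *\<^sub>C y"] by simp
  then show ?thesis using b by (simp add: b_def[symmetric] field_simps)
qed

text \<open>If \<open>B z z = 0\<close> the subtracted quotient is \<open>0\<close>, which is right because then \<open>B x z = 0\<close>.\<close>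

lemma positive_form_peel: "positive_form (\<lambda>x y. B x y - B x z * B z y / B z z)"
proof
  show "B (x + y) w - B (x + y) z * B z w / B z z =
      B x w - B x z * B z w / B z z + (B y w - B y z * B z w / B z z)" for x y w
    by (simp add: add_left algebra_simps add_divide_distrib)
  show "B (c *\<^sub>C x) y - B (c *\<^sub>C x) z * B z y / B z z = c * (B x y - B x z * B z y / B z z)" for c x y
    by (simp add: scaleC_left algebra_simps)
  show "B x y - B x z * B z y / B z z = cnj (B y x - B y z * B z x / B z z)" for x y
    by (simp add: commute[symmetric] mult.commute)
  show "0 \<le> Re (B x x - B x z * B z x / B z z)" for x
  proof -
    have "B x z * B z x / B z z = B x z * cnj (B x z) / of_real (Re (B z z))"
      using commute[of z x] self_of_real[of z] by simp
    also have "\<dots> = of_real ((cmod (B x z))\<^sup>2 / Re (B z z))"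
      by (simp add: mult_cnj_cmod)
    finally have "Re (B x z * B z x / B z z) = (cmod (B x z))\<^sup>2 / Re (B z z)"
      by simp
    moreover have "(cmod (B x z))\<^sup>2 / Re (B z z) \<le> Re (B x x)"
      using Cauchy_Schwarz[of x z] ge_zero[of z] ge_zero[of x]
      by (cases "Re (B z z) = 0") (auto simp: field_simps)
    ultimately show ?thesis by simp
  qed
qed

text \<open>A Cholesky factorization: each vector of \<open>V\<close> peels off one rank one term.
  Rows that are already zero stay zero, because the term subtracted in row \<open>v\<close> has the
  factor \<open>R v z\<close>.\<close>

lemma Gram_factorization:
  assumes "finite V"
  shows "\<exists>(m::nat) c R. positive_form R \<and> (\<forall>v\<in>V. \<forall>w. R v w = 0) \<and>
    (\<forall>v w. B v w = (\<Sum>k<m. c k v * cnj (c k w)) + R v w)"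
  using assms
proof (induction V rule: finite_induct)
  case empty
  have "positive_form B" by unfold_locales
  then show ?case by (intro exI[of _ 0] exI[of _ "\<lambda>_ _. 0"] exI[of _ B]) simp
next
  case (insert z V)
  then obtain m :: nat and c R where R: "positive_form R"
    and V: "\<And>v w. v \<in> V \<Longrightarrow> R v w = 0"
    and eq: "\<And>v w. B v w = (\<Sum>k<m. c k v * cnj (c k w)) + R v w"
    by blast
  interpret R: positive_form R by (rule R)
  define R' where "R' = (\<lambda>x y. R x y - R x z * R z y / R z z)"
  define b where "b = Re (R z z)"
  have b: "b \<ge> 0" "R z z = of_real b" using R.ge_zero[of z] R.self_of_real[of z] by (auto simp: b_def)
  \<comment> \<open>If \<open>b = 0\<close> the quotient is 0, so the new rank one term vanishes
    together with the one subtracted in \<open>R'\<close>.\<close>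
  define c' where "c' = c(m := (\<lambda>v. R v z / of_real (sqrt b)))"
  have "positive_form R'" unfolding R'_def by (rule R.positive_form_peel)
  moreover have "R' v w = 0" if "v \<in> insert z V" for v w
  proof (cases "v = z")
    case True
    \<comment> \<open>When \<open>R z z = 0\<close> nothing is subtracted and the row of
      \<open>z\<close> has to vanish by itself; otherwise the subtraction cancels it.\<close>
    have "R z w = 0" if "R z z = 0"
      using R.eq_zero_if_self_zero[of z w] that R.commute[of z w] by simp
    then show ?thesis using True by (auto simp: R'_def)
  next
    case False
    then show ?thesis using that V by (simp add: R'_def)
  qed
  moreover have "B v w = (\<Sum>k<Suc m. c' k v * cnj (c' k w)) + R' v w" for v w
  proof -
    have "c' m v * cnj (c' m w) = R v z * cnj (R w z) / (of_real (sqrt b) * of_real (sqrt b))"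
      by (simp add: c'_def)
    also have "of_real (sqrt b) * of_real (sqrt b) = R z z"
      using b by (simp flip: of_real_mult)
    also have "cnj (R w z) = R z w" by (rule R.commute[symmetric])
    finally have "c' m v * cnj (c' m w) = R v z * R z w / R z z" .
    moreover have "(\<Sum>k<m. c' k v * cnj (c' k w)) = (\<Sum>k<m. c k v * cnj (c k w))"
      by (rule sum.cong) (auto simp: c'_def)
    ultimately show ?thesis by (simp add: eq R'_def)
  qed
  ultimately show ?case by blast
qed

text \<open>Replacing scalars by vectors of a semi-inner product space does not increase the norm of
  a matrix. On the finitely many vectors involved, \<open>B\<close> is a sum of rank one forms;
  \<open>bound\<close> applies to each of them, and Cauchy-Schwarz over \<open>k\<close> recombines
  the norms.\<close>

lemma bilinear_bound:
  fixes a :: "'i \<Rightarrow> 'j \<Rightarrow> complex" and x :: "'i \<Rightarrow> 'a" and y :: "'j \<Rightarrow> 'a"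
  assumes fin: "finite I" "finite J"
    and bound: "\<And>c d. cmod (\<Sum>i\<in>I. \<Sum>j\<in>J. a i j * (c i * cnj (d j)))
      \<le> M * (L2_set (\<lambda>i. cmod (c i)) I * L2_set (\<lambda>j. cmod (d j)) J)"
    and "0 \<le> M"
  shows "cmod (\<Sum>i\<in>I. \<Sum>j\<in>J. a i j * B (x i) (y j))
    \<le> M * (sqrt (\<Sum>i\<in>I. Re (B (x i) (x i))) * sqrt (\<Sum>j\<in>J. Re (B (y j) (y j))))"
proof -
  \<comment> \<open>Both families are put into \<open>V\<close>, since the factorization is also
    applied to the diagonal values \<open>B (y j) (y j)\<close>.\<close>
  obtain m :: nat and c R where
    R: "\<And>v w. v \<in> x ` I \<union> y ` J \<Longrightarrow> R v w = 0"
    and eq0: "\<And>v w. B v w = (\<Sum>k<m. c k v * cnj (c k w)) + R v w"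
    using Gram_factorization[OF finite_UnI[OF finite_imageI[OF fin(1)] finite_imageI[OF fin(2)]], of x y]
    by (elim exE conjE) metis
  have eq: "B v w = (\<Sum>k<m. c k v * cnj (c k w))" if "v \<in> x ` I \<union> y ` J" for v w
    using eq0[of v w] R[OF that] by simp
  have diag: "(\<Sum>i\<in>K. Re (B (z i) (z i))) = (\<Sum>k<m. (L2_set (\<lambda>i. cmod (c k (z i))) K)\<^sup>2)"
    if "z ` K \<subseteq> x ` I \<union> y ` J" for z and K :: "'k set"
  proof -
    have "Re (B (z i) (z i)) = (\<Sum>k<m. (cmod (c k (z i)))\<^sup>2)" if "i \<in> K" for i
    proof -
      have "z i \<in> x ` I \<union> y ` J" using that \<open>z ` K \<subseteq> _\<close> by blast
      from eq[OF this, of "z i"] show ?thesis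
        by (simp add: mult_cnj_cmod flip: of_real_power)
    qed
    then have "(\<Sum>i\<in>K. Re (B (z i) (z i))) = (\<Sum>i\<in>K. \<Sum>k<m. (cmod (c k (z i)))\<^sup>2)"
      by simp
    also have "\<dots> = (\<Sum>k<m. \<Sum>i\<in>K. (cmod (c k (z i)))\<^sup>2)"
      by (rule sum.swap)
    also have "\<dots> = (\<Sum>k<m. (L2_set (\<lambda>i. cmod (c k (z i))) K)\<^sup>2)"
      by (simp add: L2_set_def sum_nonneg)
    finally show ?thesis .
  qed
  have "(\<Sum>i\<in>I. \<Sum>j\<in>J. a i j * B (x i) (y j))
      = (\<Sum>i\<in>I. \<Sum>j\<in>J. \<Sum>k<m. a i j * (c k (x i) * cnj (c k (y j))))"
    by (simp add: eq sum_distrib_left)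
  also have "\<dots> = (\<Sum>i\<in>I. \<Sum>k<m. \<Sum>j\<in>J. a i j * (c k (x i) * cnj (c k (y j))))"
    by (intro sum.cong refl sum.swap)
  also have "\<dots> = (\<Sum>k<m. \<Sum>i\<in>I. \<Sum>j\<in>J. a i j * (c k (x i) * cnj (c k (y j))))"
    by (rule sum.swap)
  finally have "cmod (\<Sum>i\<in>I. \<Sum>j\<in>J. a i j * B (x i) (y j))
      \<le> (\<Sum>k<m. cmod (\<Sum>i\<in>I. \<Sum>j\<in>J. a i j * (c k (x i) * cnj (c k (y j)))))"
    by (simp add: norm_sum)
  also have "\<dots> \<le> (\<Sum>k<m. M * (L2_set (\<lambda>i. cmod (c k (x i))) I * L2_set (\<lambda>j. cmod (c k (y j))) J))"
    by (intro sum_mono bound)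
  also have "\<dots> = M * (\<Sum>k<m. \<bar>L2_set (\<lambda>i. cmod (c k (x i))) I\<bar> * \<bar>L2_set (\<lambda>j. cmod (c k (y j))) J\<bar>)"
    by (simp add: sum_distrib_left)
  also have "\<dots> \<le> M * (L2_set (\<lambda>k. L2_set (\<lambda>i. cmod (c k (x i))) I) {..<m}
      * L2_set (\<lambda>k. L2_set (\<lambda>j. cmod (c k (y j))) J) {..<m})"
    by (intro mult_left_mono L2_set_mult_ineq \<open>0 \<le> M\<close>)
  also have "\<dots> = M * (sqrt (\<Sum>i\<in>I. Re (B (x i) (x i))) * sqrt (\<Sum>j\<in>J. Re (B (y j) (y j))))"
    using diag[of x I] diag[of y J] by (simp add: L2_set_def[of _ "{..<m}"])
  finally show ?thesis .
qed

end

section \<open>Hilbert space geometry and the Riesz representation\<close>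

global_interpretation cinner: positive_form "cinner :: 'a::complex_hilbert_space \<Rightarrow> 'a \<Rightarrow> complex"
  by unfold_locales (rule cinner_add_left cinner_scaleC_left cinner_commute cinner_ge_zero)+

lemma cinner_self: "cinner x x = of_real ((norm x)\<^sup>2)" for x :: "'a::complex_hilbert_space"
  using cinner.self_of_real[of x] by (simp add: norm_eq_sqrt_cinner cinner_ge_zero)

lemma norm_cinner_le: "cmod (cinner x y) \<le> norm x * norm y" for x :: "'a::complex_hilbert_space"
proof -
  have "(cmod (cinner x y))\<^sup>2 \<le> (norm x * norm y)\<^sup>2"
    using cinner.Cauchy_Schwarz[of x y] by (simp add: cinner_self power_mult_distrib)
  then show ?thesis by (rule power2_le_imp_le) simp
qed

lemma norm_le_if_cinner_le:
  fixes x :: "'a::complex_hilbert_space"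
  assumes "\<And>y. cmod (cinner x y) \<le> K * norm y" and "0 \<le> K"
  shows "norm x \<le> K"
proof (cases "x = 0")
  case True
  then show ?thesis using \<open>0 \<le> K\<close> by simp
next
  case False
  have "norm x * norm x \<le> K * norm x"
    using assms(1)[of x] by (simp add: cinner_self power2_eq_square norm_mult)
  then show ?thesis using False by simp
qed

lemma cinner_eq_imp_eq:
  fixes x :: "'a::complex_hilbert_space"
  assumes "\<And>z. cinner z x = cinner z y"
  shows "x = y"
  using assms[of "x - y"] by (metis cinner.diff_right cinner_eq_zero_iff eq_iff_diff_eq_0)

lemma norm_add_power2:
  "(norm (x + y))\<^sup>2 = (norm x)\<^sup>2 + (norm y)\<^sup>2 + 2 * Re (cinner y x)"
  for x :: "'a::complex_hilbert_space"
proof -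
  have "cinner (x + y) (x + y) = cinner x x + cinner y y + (cnj (cinner y x) + cinner y x)"
    using cinner_commute[of x y] by (simp add: cinner.add_left cinner.add_right)
  then have "Re (cinner (x + y) (x + y)) = Re (cinner x x) + Re (cinner y y) + 2 * Re (cinner y x)"
    by simp
  then show ?thesis by (simp add: cinner_self)
qed

lemma parallelogram_law:
  "(norm (x - y))\<^sup>2 + (norm (x + y))\<^sup>2 = 2 * (norm x)\<^sup>2 + 2 * (norm y)\<^sup>2"
  for x :: "'a::complex_hilbert_space"
  using norm_add_power2[of x y] norm_add_power2[of x "- y"] by (simp add: cinner.minus_left)

lemma bounded_linear_scaleC_functional:
  fixes \<phi> :: "'a::complex_hilbert_space \<Rightarrow> complex"
  assumes "\<And>x y. \<phi> (x + y) = \<phi> x + \<phi> y" "\<And>c x. \<phi> (c *\<^sub>C x) = c * \<phi> x"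
    "\<And>x. cmod (\<phi> x) \<le> K * norm x"
  shows "bounded_linear \<phi>"
  by (rule bounded_linear_intro[of _ K])
    (use assms in \<open>auto simp: scaleR_scaleC scaleR_conv_of_real mult.commute\<close>)

text \<open>The representing vector minimizes
  \<open>J x = (norm x)\<^sup>2 - 2 * Re (\<phi> x)\<close>. The parallelogram law makes a
  minimizing sequence Cauchy, and the vanishing first variation at the limit identifies the real
  parts.\<close>

lemma Riesz_representation:
  fixes \<phi> :: "'a::complex_hilbert_space \<Rightarrow> complex"
  assumes add: "\<And>x y. \<phi> (x + y) = \<phi> x + \<phi> y"
    and scale: "\<And>c x. \<phi> (c *\<^sub>C x) = c * \<phi> x"
    and bound: "\<And>x. cmod (\<phi> x) \<le> K * norm x"
  obtains z where "\<And>x. \<phi> x = cinner x z"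
proof -
  interpret \<phi>: bounded_linear \<phi> by (rule bounded_linear_scaleC_functional[OF assms])
  define J where "J x = (norm x)\<^sup>2 - 2 * Re (\<phi> x)" for x
  have "J x \<ge> - K\<^sup>2" for x
  proof -
    have "Re (\<phi> x) \<le> K * norm x"
      using bound[of x] complex_Re_le_cmod[of "\<phi> x"] by linarith
    moreover have "0 \<le> (norm x - K)\<^sup>2" by simp
    ultimately show ?thesis by (simp add: J_def power2_diff mult.commute)
  qed
  then have bdd: "bdd_below (range J)" by (auto simp: bdd_below_def)
  define d where "d = Inf (range J)"
  have d: "d \<le> J x" for x
    unfolding d_def by (rule cInf_lower) (use bdd in auto)
  \<comment> \<open>At the midpoint \<open>J\<close> is at least \<open>d\<close>, so two
    near-minimizers are close to each other.\<close>
  have para: "(norm (x - y))\<^sup>2 = 2 * J x + 2 * J y - 4 * J ((1/2) *\<^sub>R (x + y))" for x y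
    using parallelogram_law[of x y]
    by (simp add: J_def \<phi>.scaleR \<phi>.add power_mult_distrib power_divide add_divide_distrib)
  have "\<exists>x. J x < d + inverse (real (Suc n))" for n
  proof -
    have "Inf (range J) < d + inverse (real (Suc n))" by (simp add: d_def)
    then show ?thesis by (subst (asm) cInf_less_iff) (use bdd in auto)
  qed
  then obtain s where s: "\<And>n. J (s n) < d + inverse (real (Suc n))" by metis
  have "Cauchy s"
  proof (rule metric_CauchyI)
    fix e :: real assume e: "e > 0"
    \<comment> \<open>The excess of \<open>J\<close> over \<open>d\<close> enters
      \<open>para\<close> with weight 2 for each of the two terms, hence the quarter.\<close>
    obtain M where M: "inverse (real (Suc M)) < e\<^sup>2 / 4"
      using reals_Archimedean[of "e\<^sup>2 / 4"] e by auto
    have "dist (s m) (s n) < e" if "m \<ge> M" "n \<ge> M" for m n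
    proof -
      have "inverse (real (Suc m)) \<le> inverse (real (Suc M))" "inverse (real (Suc n)) \<le> inverse (real (Suc M))"
        using that by (auto intro!: le_imp_inverse_le)
      then have "(norm (s m - s n))\<^sup>2 < e\<^sup>2"
        using para[of "s m" "s n"] d[of "(1/2) *\<^sub>R (s m + s n)"] s[of m] s[of n] M by linarith
      then show ?thesis using e by (simp add: dist_norm power2_less_imp_less)
    qed
    then show "\<exists>M. \<forall>m\<ge>M. \<forall>n\<ge>M. dist (s m) (s n) < e" by blast
  qed
  then obtain z where z: "s \<longlonglongrightarrow> z" using Cauchy_convergent_iff convergent_def by blast
  have "(\<lambda>n. J (s n)) \<longlonglongrightarrow> J z"
    unfolding J_def by (intro tendsto_intros z \<phi>.tendsto)
  moreover have "(\<lambda>n. d + inverse (real (Suc n))) \<longlonglongrightarrow> d + 0"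
    by (intro tendsto_intros LIMSEQ_inverse_real_of_nat)
  ultimately have "J z \<le> d + 0"
    by (rule LIMSEQ_le) (use s in \<open>auto intro: less_imp_le\<close>)
  then have min: "J z \<le> J x" for x using d[of x] by simp
  have re: "Re (\<phi> y) = Re (cinner y z)" for y
  proof (rule ccontr)
    assume "Re (\<phi> y) \<noteq> Re (cinner y z)"
    define g where "g = Re (cinner y z) - Re (\<phi> y)"
    have g: "g \<noteq> 0" using \<open>Re (\<phi> y) \<noteq> _\<close> by (simp add: g_def)
    \<comment> \<open>The right side is \<open>J (z + t *\<^sub>R y) - J z\<close>.\<close>
    have *: "0 \<le> t\<^sup>2 * (norm y)\<^sup>2 + 2 * t * g" for t :: real
      using min[of "z + t *\<^sub>R y"] norm_add_power2[of z "t *\<^sub>R y"]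
      by (simp add: J_def \<phi>.add \<phi>.scaleR power_mult_distrib g_def
          cinner.scaleR_left algebra_simps)
    \<comment> \<open>At \<open>t = - (g / N)\<close> the expression is at most
      \<open>- (g\<^sup>2 / N)\<close>. The added 1 keeps \<open>N\<close> positive for
      \<open>y = 0\<close>.\<close>
    define N where "N = (norm y)\<^sup>2 + 1"
    have N: "N > 0" by (simp add: N_def add_nonneg_pos)
    have "0 \<le> (g / N)\<^sup>2 * (norm y)\<^sup>2 - 2 * g\<^sup>2 / N"
      using *[of "- (g / N)"] by (simp add: power2_eq_square)
    also have "(g / N)\<^sup>2 * (norm y)\<^sup>2 \<le> (g / N)\<^sup>2 * N"
      by (intro mult_left_mono) (auto simp: N_def)
    also have "(g / N)\<^sup>2 * N - 2 * g\<^sup>2 / N = - (g\<^sup>2 / N)"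
      using N by (simp add: power2_eq_square field_simps)
    finally show False using N g by (simp add: field_simps)
  qed
  have "\<phi> y = cinner y z" for y
  proof (rule complex_eqI[OF re])
    show "Im (\<phi> y) = Im (cinner y z)"
      using re[of "\<i> *\<^sub>C y"] by (simp add: scale cinner.scaleC_left)
  qed
  then show thesis by (rule that)
qed

section \<open>Adjoints, row norms and creation operators\<close>

lemma norm_le_if_cinner_le':
  fixes x :: "'a::complex_hilbert_space"
  assumes "\<And>y. cmod (cinner y x) \<le> K * norm y" and "0 \<le> K"
  shows "norm x \<le> K"
  by (rule norm_le_if_cinner_le) (use assms cinner_commute[of x] in \<open>auto simp: complex_mod_cnj\<close>)

text \<open>Riesz gives a vector \<open>g y\<close> for each functional
  \<open>\<lambda>x. F x y\<close>. It depends linearly on \<open>y\<close> because \<open>F\<close>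
  and the inner product are both conjugate linear in the second argument. Adjoints and shift
  operators are constructed this way.\<close>

lemma sesquilinear_representation:
  fixes F :: "'a::complex_hilbert_space \<Rightarrow> 'a \<Rightarrow> complex"
  assumes add_left: "\<And>x y z. F (x + y) z = F x z + F y z"
    and scale_left: "\<And>c x z. F (c *\<^sub>C x) z = c * F x z"
    and add_right: "\<And>x y z. F x (y + z) = F x y + F x z"
    and scale_right: "\<And>c x z. F x (c *\<^sub>C z) = cnj c * F x z"
    and bound: "\<And>x y. cmod (F x y) \<le> K * norm x * norm y" and K: "0 \<le> K"
  obtains A where "A \<in> bounded_operators" "\<And>x y. F x y = cinner x (blinfun_apply A y)"
proof -
  have "\<exists>w. \<forall>x. F x y = cinner x w" for y
    by (rule Riesz_representation[of "\<lambda>x. F x y" "K * norm y"])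
      (use assms in \<open>auto simp: mult_ac\<close>)
  then obtain g where g: "\<And>x y. F x y = cinner x (g y)" by metis
  have add: "g (x + y) = g x + g y" for x y
    by (rule cinner_eq_imp_eq) (simp add: cinner.add_right add_right flip: g)
  have scale: "g (c *\<^sub>C x) = c *\<^sub>C g x" for c x
    by (rule cinner_eq_imp_eq) (simp add: cinner.scaleC_right scale_right flip: g)
  have "norm (g y) \<le> norm y * K" for y
    by (rule norm_le_if_cinner_le') (use bound[of _ y] K in \<open>auto simp: mult_ac simp flip: g\<close>)
  then have bl: "bounded_linear g"
    by (intro bounded_linear_intro[of g K]) (auto simp: add scale scaleR_scaleC)
  show thesis
    by (rule that[of "Blinfun g"])
      (auto simp: bounded_operators_def bounded_linear_Blinfun_apply[OF bl] scale g)
qed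

text \<open>Vectors are separated by their inner products, so the description in
  \<open>adjoint_op\<close> has at most one solution and any solution found is the adjoint.\<close>

lemma adjoint_op_eqI:
  assumes "\<And>x y. cinner (blinfun_apply A x) y = cinner x (blinfun_apply B y)"
  shows "adjoint_op A = B"
  unfolding adjoint_op_def
proof (rule the_equality)
  fix C assume "\<forall>x y. cinner (blinfun_apply A x) y = cinner x (blinfun_apply C y)"
  then show "C = B"
    by (intro blinfun_eqI cinner_eq_imp_eq) (simp flip: assms)
qed (use assms in blast)

lemma bounded_operators_scaleC:
  "A \<in> bounded_operators \<Longrightarrow> blinfun_apply A (c *\<^sub>C x) = c *\<^sub>C blinfun_apply A x"
  by (simp add: bounded_operators_def)

lemma adjoint_op_exists:
  assumes "A \<in> bounded_operators"
  obtains B where "B \<in> bounded_operators" "\<And>x y. cinner (blinfun_apply A x) y = cinner x (blinfun_apply B y)"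
proof (rule sesquilinear_representation[of "\<lambda>x y. cinner (blinfun_apply A x) y" "norm A"])
  show "cmod (cinner (blinfun_apply A x) y) \<le> norm A * norm x * norm y" for x y
    by (rule order_trans[OF norm_cinner_le]) (intro mult_right_mono norm_blinfun norm_ge_zero)
qed (auto simp: blinfun.add_right bounded_operators_scaleC[OF assms] cinner.add_left cinner.add_right
    cinner.scaleC_left cinner.scaleC_right that)

lemma adjoint_op_mem: "A \<in> bounded_operators \<Longrightarrow> adjoint_op A \<in> bounded_operators"
  by (metis adjoint_op_exists adjoint_op_eqI)

lemma cinner_adjoint_op:
  "A \<in> bounded_operators \<Longrightarrow> cinner (blinfun_apply A x) y = cinner x (blinfun_apply (adjoint_op A) y)"
  by (metis adjoint_op_exists adjoint_op_eqI)

lemma bounded_operators_scaleR: "A \<in> bounded_operators \<Longrightarrow> r *\<^sub>R A \<in> bounded_operators"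
  by (simp add: bounded_operators_def blinfun.scaleR_left scaleR_scaleC scaleC_scaleC mult.commute)

lemma adjoint_op_scaleR:
  assumes "A \<in> bounded_operators"
  shows "adjoint_op (r *\<^sub>R A) = r *\<^sub>R adjoint_op A"
  by (rule adjoint_op_eqI)
    (simp add: blinfun.scaleR_left scaleR_scaleC cinner.scaleC_left cinner.scaleC_right
      cinner_adjoint_op[OF assms])

section \<open>Row norms in terms of adjoints\<close>

lemma operator_tuples_scaleR: "X \<in> operator_tuples \<Longrightarrow> r *\<^sub>R X \<in> operator_tuples"
  by (simp add: operator_tuples_def bounded_operators_scaleR)

lemma row_norm_scaleR:
  assumes "X \<in> operator_tuples"
  shows "row_norm (r *\<^sub>R X) = \<bar>r\<bar> * row_norm X"
proof -
  have "(r *\<^sub>R X) $ i o\<^sub>L adjoint_op ((r *\<^sub>R X) $ i) = r\<^sup>2 *\<^sub>R (X $ i o\<^sub>L adjoint_op (X $ i))" for i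
    using assms
    by (intro blinfun_eqI)
      (simp add: operator_tuples_def adjoint_op_scaleR blinfun.scaleR_left blinfun.scaleR_right power2_eq_square)
  then show ?thesis
    by (simp add: row_norm_def real_sqrt_mult flip: scaleR_sum_right)
qed

text \<open>Moving each \<open>X $ i\<close> across the inner product turns the operator in
  \<open>row_norm\<close> into a Gram sum of the adjoints, the form in which contractivity is
  used.\<close>

lemma cinner_row_product:
  fixes X :: "('a::complex_hilbert_space \<Rightarrow>\<^sub>L 'a) ^ 'n::finite"
  assumes "X \<in> operator_tuples"
  shows "cinner (blinfun_apply (\<Sum>i\<in>UNIV. X $ i o\<^sub>L adjoint_op (X $ i)) x) y
    = (\<Sum>i\<in>UNIV. cinner (blinfun_apply (adjoint_op (X $ i)) x) (blinfun_apply (adjoint_op (X $ i)) y))"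
  using assms
  by (simp add: blinfun.sum_left cinner.sum_left cinner_adjoint_op operator_tuples_def)

lemma sum_norm_adjoint_le:
  fixes X :: "('a::complex_hilbert_space \<Rightarrow>\<^sub>L 'a) ^ 'n::finite"
  assumes "X \<in> operator_tuples"
  shows "(\<Sum>i\<in>UNIV. (norm (blinfun_apply (adjoint_op (X $ i)) x))\<^sup>2) \<le> (row_norm X)\<^sup>2 * (norm x)\<^sup>2"
proof -
  let ?P = "\<Sum>i\<in>UNIV. X $ i o\<^sub>L adjoint_op (X $ i)"
  have "(\<Sum>i\<in>UNIV. (norm (blinfun_apply (adjoint_op (X $ i)) x))\<^sup>2) = Re (cinner (blinfun_apply ?P x) x)"
    by (simp add: cinner_row_product[OF assms] cinner_self)
  also have "\<dots> \<le> norm (blinfun_apply ?P x) * norm x"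
    using norm_cinner_le complex_Re_le_cmod order_trans by blast
  also have "\<dots> \<le> norm ?P * norm x * norm x"
    by (intro mult_right_mono norm_blinfun norm_ge_zero)
  finally show ?thesis by (simp add: row_norm_def power2_eq_square)
qed

text \<open>By \<open>cinner_row_product\<close>, the row product is tested against pairs
  \<open>x\<close>, \<open>y\<close>; Cauchy-Schwarz is applied to each inner product and then to
  the sum over \<open>i\<close>.\<close>

lemma row_norm_le_one:
  fixes X :: "('a::complex_hilbert_space \<Rightarrow>\<^sub>L 'a) ^ 'n::finite"
  assumes X: "X \<in> operator_tuples"
    and bound: "\<And>x. (\<Sum>i\<in>UNIV. (norm (blinfun_apply (adjoint_op (X $ i)) x))\<^sup>2) \<le> (norm x)\<^sup>2"
  shows "row_norm X \<le> 1"
proof -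
  let ?T = "\<lambda>i. blinfun_apply (adjoint_op (X $ i))"
  let ?P = "\<Sum>i\<in>UNIV. X $ i o\<^sub>L adjoint_op (X $ i)"
  have L2: "L2_set (\<lambda>i. norm (?T i x)) UNIV \<le> norm x" for x
    unfolding L2_set_def using real_sqrt_le_mono[OF bound[of x]] by simp
  have "norm (blinfun_apply ?P x) \<le> norm x" for x
  proof (rule norm_le_if_cinner_le)
    fix y
    have "cmod (cinner (blinfun_apply ?P x) y) \<le> (\<Sum>i\<in>UNIV. cmod (cinner (?T i x) (?T i y)))"
      unfolding cinner_row_product[OF X] by (rule norm_sum)
    also have "\<dots> \<le> (\<Sum>i\<in>UNIV. \<bar>norm (?T i x)\<bar> * \<bar>norm (?T i y)\<bar>)"
      by (rule sum_mono) (simp add: norm_cinner_le)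
    also have "\<dots> \<le> L2_set (\<lambda>i. norm (?T i x)) UNIV * L2_set (\<lambda>i. norm (?T i y)) UNIV"
      by (rule L2_set_mult_ineq)
    also have "\<dots> \<le> norm x * norm y"
      by (intro mult_mono L2 L2_set_nonneg norm_ge_zero)
    finally show "cmod (cinner (blinfun_apply ?P x) y) \<le> norm x * norm y" .
  qed simp
  then have "norm ?P \<le> 1" by (intro norm_blinfun_bound) auto
  then show ?thesis by (simp add: row_norm_def)
qed

section \<open>Orthonormal families and creation operators\<close>

definition orthonormal :: "('i \<Rightarrow> 'a::complex_hilbert_space) \<Rightarrow> bool" where
  "orthonormal e \<longleftrightarrow> (\<forall>i j. cinner (e i) (e j) = (if i = j then 1 else 0))"

lemma orthonormal_compose: "orthonormal e \<Longrightarrow> inj g \<Longrightarrow> orthonormal (\<lambda>i. e (g i))"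
  by (simp add: orthonormal_def inj_eq)

lemma orthonormal_norm: "orthonormal e \<Longrightarrow> norm (e i) = 1"
  by (simp add: orthonormal_def norm_eq_sqrt_cinner)

lemma norm_sum_orthonormal:
  assumes "orthonormal e" "finite F"
  shows "norm (\<Sum>i\<in>F. c i *\<^sub>C e i) = L2_set (\<lambda>i. cmod (c i)) F"
proof -
  have "cinner (\<Sum>i\<in>F. c i *\<^sub>C e i) (\<Sum>i\<in>F. c i *\<^sub>C e i)
      = (\<Sum>i\<in>F. \<Sum>j\<in>F. if j = i then c i * cnj (c i) else 0)"
    unfolding cinner.sum_left cinner.sum_right
    by (intro sum.cong refl) (use assms(1) in \<open>auto simp: cinner.scaleC_left cinner.scaleC_right orthonormal_def\<close>)
  also have "\<dots> = of_real (\<Sum>i\<in>F. (cmod (c i))\<^sup>2)"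
    using assms(2) by (simp add: mult_cnj_cmod)
  finally show ?thesis by (simp add: norm_eq_sqrt_cinner L2_set_def)
qed

text \<open>The partial expansion \<open>y\<close> satisfies \<open>norm y = sqrt s\<close> and
  \<open>cinner x y = s\<close>, so Cauchy-Schwarz gives
  \<open>s \<le> norm x * sqrt s\<close>.\<close>

lemma Bessel_inequality:
  assumes "orthonormal e" "finite F"
  shows "(\<Sum>i\<in>F. (cmod (cinner x (e i)))\<^sup>2) \<le> (norm x)\<^sup>2"
proof -
  define s where "s = (\<Sum>i\<in>F. (cmod (cinner x (e i)))\<^sup>2)"
  define y where "y = (\<Sum>i\<in>F. cinner x (e i) *\<^sub>C e i)"
  have "s \<ge> 0" by (simp add: s_def sum_nonneg)
  have "norm y = sqrt s"
    unfolding y_def s_def norm_sum_orthonormal[OF assms] L2_set_def ..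
  moreover have "cinner x y = of_real s"
    by (simp add: y_def s_def cinner.sum_right cinner.scaleC_right mult.commute[of "cnj _"] mult_cnj_cmod)
  ultimately have "sqrt s * sqrt s \<le> norm x * sqrt s"
    using norm_cinner_le[of x y] \<open>s \<ge> 0\<close> by simp
  then have "sqrt s \<le> norm x"
  proof (cases "s = 0")
    case False
    then have "0 < sqrt s" using \<open>s \<ge> 0\<close> by simp
    with \<open>sqrt s * sqrt s \<le> norm x * sqrt s\<close> show ?thesis by (rule mult_right_le_imp_le)
  qed simp
  then show ?thesis unfolding s_def[symmetric] by (rule sqrt_le_D)
qed

lemma coefficients_summable:
  assumes "orthonormal e"
  shows "(\<lambda>i. (cmod (cinner x (e i)))\<^sup>2) summable_on UNIV"
  by (rule nonneg_bdd_above_summable_on)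
    (use Bessel_inequality[OF assms, of _ x] in \<open>auto simp: bdd_above_def\<close>)

text \<open>The operator is the partial isometry taking \<open>e\<close> to \<open>e'\<close>. Its
  adjoint is bounded by the coefficients along \<open>e'\<close> alone, which is finer than a bound
  by \<open>norm z\<close>: the estimates for several operators with orthogonal ranges can then be
  added.\<close>

lemma orthonormal_shift_operator:
  fixes e e' :: "'i \<Rightarrow> 'a::complex_hilbert_space"
  assumes e: "orthonormal e" and e': "orthonormal e'"
  obtains A where "A \<in> bounded_operators" "\<And>i. blinfun_apply A (e i) = e' i"
    "\<And>z. (norm (blinfun_apply (adjoint_op A) z))\<^sup>2 \<le> (\<Sum>\<^sub>\<infinity>i. (cmod (cinner z (e' i)))\<^sup>2)"
proof -
  \<comment> \<open>This is \<open>cinner z (A x)\<close> for the intended \<open>A x\<close>, the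
    sum of all \<open>cinner x (e i) *\<^sub>C e' i\<close>.\<close>
  define F where "F z x = (\<Sum>\<^sub>\<infinity>i. cinner z (e' i) * cinner (e i) x)" for z x
  define \<beta> where "\<beta> z = (\<Sum>\<^sub>\<infinity>i. (cmod (cinner z (e' i)))\<^sup>2)" for z
  have \<beta>_nonneg: "0 \<le> \<beta> z" for z unfolding \<beta>_def by (rule infsum_nonneg) simp
  have \<beta>_le: "\<beta> z \<le> (norm z)\<^sup>2" for z
    unfolding \<beta>_def by (rule infsum_le_finite_sums) (use coefficients_summable[OF e'] Bessel_inequality[OF e'] in auto)
  have fin: "(\<Sum>i\<in>S. cmod (cinner z (e' i) * cinner (e i) x)) \<le> sqrt (\<beta> z) * norm x"
    if "finite S" for S z x
  proof -
    have "(\<Sum>i\<in>S. cmod (cinner z (e' i) * cinner (e i) x))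
        = (\<Sum>i\<in>S. \<bar>cmod (cinner z (e' i))\<bar> * \<bar>cmod (cinner x (e i))\<bar>)"
      by (rule sum.cong) (auto simp: norm_mult cinner_commute[of _ x])
    also have "\<dots> \<le> L2_set (\<lambda>i. cmod (cinner z (e' i))) S * L2_set (\<lambda>i. cmod (cinner x (e i))) S"
      by (rule L2_set_mult_ineq)
    also have "\<dots> \<le> sqrt (\<beta> z) * norm x"
    proof (intro mult_mono L2_set_nonneg)
      show "L2_set (\<lambda>i. cmod (cinner z (e' i))) S \<le> sqrt (\<beta> z)"
        unfolding L2_set_def \<beta>_def
        by (intro real_sqrt_le_mono finite_sum_le_infsum coefficients_summable[OF e'] that) auto
      show "L2_set (\<lambda>i. cmod (cinner x (e i))) S \<le> norm x"
        unfolding L2_set_def by (rule real_le_lsqrt) (use Bessel_inequality[OF e that] in \<open>auto simp: sum_nonneg\<close>)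
    qed (simp add: \<beta>_nonneg)
    finally show ?thesis .
  qed
  have abs: "(\<lambda>i. cmod (cinner z (e' i) * cinner (e i) x)) summable_on UNIV" for z x
    by (rule nonneg_bdd_above_summable_on) (use fin[of _ z x] in \<open>auto simp: bdd_above_def\<close>)
  note summ = abs_summable_summable[OF abs]
  \<comment> \<open>This sharp bound yields the adjoint estimate; the coarser \<open>F1\<close>
    yields boundedness of the operator.\<close>
  have F_le: "cmod (F z x) \<le> sqrt (\<beta> z) * norm x" for z x
    unfolding F_def using norm_infsum_bound[OF abs[of z x]]
      infsum_le_finite_sums[OF abs[of z x] fin[of _ z x]] by (simp add: order_trans)
  have F1: "cmod (F z x) \<le> 1 * norm z * norm x" for z x
  proof -
    have "sqrt (\<beta> z) \<le> norm z" using \<beta>_le[of z] by (simp add: real_le_lsqrt)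
    then have "sqrt (\<beta> z) * norm x \<le> norm z * norm x" by (simp add: mult_right_mono)
    then show ?thesis using F_le[of z x] by simp
  qed
  obtain A where A: "A \<in> bounded_operators" "\<And>x y. F x y = cinner x (blinfun_apply A y)"
  proof (rule sesquilinear_representation[of F 1])
    show "F (x + y) z = F x z + F y z" for x y z
      unfolding F_def by (simp add: cinner.add_left distrib_right infsum_add[OF summ summ])
    show "F x (y + z) = F x y + F x z" for x y z
      unfolding F_def by (simp add: cinner.add_right distrib_left infsum_add[OF summ summ])
    show "F (c *\<^sub>C x) z = c * F x z" for c x z
      unfolding F_def by (simp add: cinner.scaleC_left mult.assoc infsum_cmult_right')
    show "F x (c *\<^sub>C z) = cnj c * F x z" for c x z
      unfolding F_def by (simp add: cinner.scaleC_right mult.left_commute infsum_cmult_right')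
  qed (use F1 in auto)
  show thesis
  proof (rule that[of A])
    show "blinfun_apply A (e i) = e' i" for i
    proof (rule cinner_eq_imp_eq)
      fix z
      have "((\<lambda>j. cinner z (e' j) * cinner (e j) (e i)) has_sum cinner z (e' i)) UNIV"
        by (rule has_sum_finite_neutralI[of "{i}"]) (use e in \<open>auto simp: orthonormal_def\<close>)
      then show "cinner z (blinfun_apply A (e i)) = cinner z (e' i)"
        unfolding A(2)[symmetric] F_def by (rule infsumI)
    qed
    show "(norm (blinfun_apply (adjoint_op A) z))\<^sup>2 \<le> (\<Sum>\<^sub>\<infinity>i. (cmod (cinner z (e' i)))\<^sup>2)" for z
    proof -
      have "norm (blinfun_apply (adjoint_op A) z) \<le> sqrt (\<beta> z)"
      proof (rule norm_le_if_cinner_le')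
        fix y
        have "cmod (cinner y (blinfun_apply (adjoint_op A) z)) = cmod (F z y)"
          using cinner_commute[of "blinfun_apply A y" z] by (simp add: A(2) flip: cinner_adjoint_op[OF A(1)])
        then show "cmod (cinner y (blinfun_apply (adjoint_op A) z)) \<le> sqrt (\<beta> z) * norm y"
          using F_le by simp
      qed (simp add: \<beta>_nonneg)
      then show ?thesis unfolding \<beta>_def[symmetric] using sqrt_ge_absD by fastforce
    qed
  qed (rule A(1))
qed

text \<open>Words with different first letters are different, so the ranges are orthogonal and the
  adjoint estimates add up to a single Bessel sum; hence row norm at most 1. The vector
  \<open>e [i]\<close>, which the adjoint of \<open>X $ i\<close> does not shorten, gives the lower
  bound.\<close>

lemma creation_operators:
  fixes e :: "'n::finite list \<Rightarrow> 'a::complex_hilbert_space"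
  assumes e: "orthonormal e"
  obtains X :: "('a \<Rightarrow>\<^sub>L 'a) ^ 'n" where "X \<in> row_sphere"
    "\<And>i \<alpha>. blinfun_apply (X $ i) (e \<alpha>) = e (i # \<alpha>)"
proof -
  have e': "orthonormal (\<lambda>\<alpha>. e (i # \<alpha>))" for i
    by (rule orthonormal_compose[OF e]) (simp add: inj_def)
  have "\<exists>A. A \<in> bounded_operators \<and> (\<forall>\<alpha>. blinfun_apply A (e \<alpha>) = e (i # \<alpha>)) \<and>
    (\<forall>z. (norm (blinfun_apply (adjoint_op A) z))\<^sup>2 \<le> (\<Sum>\<^sub>\<infinity>\<alpha>. (cmod (cinner z (e (i # \<alpha>))))\<^sup>2))" for i
    by (rule orthonormal_shift_operator[OF e e'[of i]]) blast
  then obtain A where A: "\<And>i. A i \<in> bounded_operators"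
    "\<And>i \<alpha>. blinfun_apply (A i) (e \<alpha>) = e (i # \<alpha>)"
    "\<And>i z. (norm (blinfun_apply (adjoint_op (A i)) z))\<^sup>2 \<le> (\<Sum>\<^sub>\<infinity>\<alpha>. (cmod (cinner z (e (i # \<alpha>))))\<^sup>2)"
    by metis
  define X where "X = (\<chi> i. A i)"
  have X: "X \<in> operator_tuples" by (simp add: X_def operator_tuples_def A)
  have bound: "(\<Sum>i\<in>UNIV. (norm (blinfun_apply (adjoint_op (X $ i)) z))\<^sup>2) \<le> (norm z)\<^sup>2" for z
  proof -
    let ?g = "\<lambda>\<alpha>. (cmod (cinner z (e \<alpha>)))\<^sup>2"
    \<comment> \<open>The infinite sums are limits over finite sets \<open>S\<close> of words, and
      for each \<open>S\<close> the double sum is a Bessel sum over the distinct words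
      \<open>i # \<alpha>\<close>.\<close>
    have "((\<lambda>S. \<Sum>i\<in>UNIV. sum (\<lambda>\<alpha>. ?g (i # \<alpha>)) S) \<longlongrightarrow> (\<Sum>i\<in>UNIV. \<Sum>\<^sub>\<infinity>\<alpha>. ?g (i # \<alpha>)))
        (finite_subsets_at_top UNIV)"
      by (intro tendsto_sum has_sum_infsum[OF coefficients_summable[OF e'], unfolded has_sum_def])
    moreover have "(\<Sum>i\<in>UNIV. sum (\<lambda>\<alpha>. ?g (i # \<alpha>)) S) \<le> (norm z)\<^sup>2" if "finite S" for S
    proof -
      have "(\<Sum>i\<in>UNIV. sum (\<lambda>\<alpha>. ?g (i # \<alpha>)) S) = (\<Sum>(i, \<alpha>)\<in>UNIV \<times> S. ?g (i # \<alpha>))"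
        by (rule sum.cartesian_product)
      also have "\<dots> = sum ?g ((\<lambda>(i, \<alpha>). i # \<alpha>) ` (UNIV \<times> S))"
        by (subst sum.reindex) (auto simp: inj_on_def case_prod_unfold o_def)
      also have "\<dots> \<le> (norm z)\<^sup>2"
        by (rule Bessel_inequality[OF e]) (simp add: that)
      finally show ?thesis .
    qed
    ultimately have "(\<Sum>i\<in>UNIV. \<Sum>\<^sub>\<infinity>\<alpha>. ?g (i # \<alpha>)) \<le> (norm z)\<^sup>2"
      by (elim tendsto_upperbound) (auto intro: eventually_finite_subsets_at_top_weakI)
    then show ?thesis
      using sum_mono[of UNIV "\<lambda>i. (norm (blinfun_apply (adjoint_op (A i)) z))\<^sup>2", OF A(3)]
      by (simp add: X_def)
  qed
  \<comment> \<open>Types are nonempty, so at least one letter is available.\<close>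
  obtain i :: 'n where True by simp
  let ?w = "blinfun_apply (adjoint_op (X $ i)) (e [i])"
  have "cinner (e []) ?w = 1"
    using e by (simp add: X_def A orthonormal_def flip: cinner_adjoint_op)
  then have "1 \<le> norm ?w"
    using norm_cinner_le[of "e []" ?w] by (simp add: orthonormal_norm[OF e])
  then have "1 \<le> (norm ?w)\<^sup>2" by (simp add: one_le_power)
  also have "(norm ?w)\<^sup>2 \<le> (\<Sum>j\<in>UNIV. (norm (blinfun_apply (adjoint_op (X $ j)) (e [i])))\<^sup>2)"
    by (rule member_le_sum) auto
  also have "\<dots> \<le> (row_norm X)\<^sup>2"
    using sum_norm_adjoint_le[OF X, of "e [i]"] by (simp add: orthonormal_norm[OF e])
  finally have "row_norm X \<ge> 1"
    by (simp add: row_norm_def)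
  moreover have "row_norm X \<le> 1" by (rule row_norm_le_one[OF X bound])
  ultimately show thesis
    using X by (intro that[of X]) (simp add: row_sphere_def, simp add: X_def A)
qed

section \<open>The noncommutative von Neumann inequality\<close>

text \<open>Gram-Schmidt: the vectors found so far never span, so a vector outside their span minus
  its projection is nonzero and can be normalized.\<close>

lemma orthonormal_sequence_exists:
  assumes "\<not> (\<exists>B :: 'a::complex_hilbert_space set. finite B \<and> complex_vector.span B = UNIV)"
  obtains e :: "nat \<Rightarrow> 'a::complex_hilbert_space" where "orthonormal e"
proof -
  define P where "P f n r \<longleftrightarrow> norm r = 1 \<and> (\<forall>m<n. cinner r (f m) = 0)" for f :: "nat \<Rightarrow> 'a" and n r
  have "\<exists>f. \<forall>n. P f n (f n)"
  proof (rule dependent_wellorder_choice)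
    fix n :: nat and f :: "nat \<Rightarrow> 'a"
    assume IH: "\<And>m. m < n \<Longrightarrow> P f m (f m)"
    \<comment> \<open>\<open>P\<close> controls inner products with earlier vectors only; conjugate
      symmetry gives the remaining ones.\<close>
    have ortho: "cinner (f l) (f m) = (if l = m then 1 else 0)" if "l < n" "m < n" for l m
      using IH[OF that(1)] IH[OF that(2)] cinner_commute[of "f l" "f m"]
      by (cases l m rule: linorder_cases) (auto simp: P_def cinner_self)
    obtain z where z: "z \<notin> complex_vector.span (f ` {..<n})"
      using assms by (metis UNIV_eq_I finite_imageI finite_lessThan)
    define w where "w = z - (\<Sum>l<n. cinner z (f l) *\<^sub>C f l)"
    have "(\<Sum>l<n. cinner z (f l) *\<^sub>C f l) \<in> complex_vector.span (f ` {..<n})"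
      by (intro complex_vector.span_sum complex_vector.span_scale complex_vector.span_base) auto
    with z have "w \<noteq> 0" by (auto simp: w_def)
    have "cinner w (f m) = 0" if "m < n" for m
    proof -
      have "(\<Sum>l<n. cinner z (f l) * cinner (f l) (f m)) = (\<Sum>l<n. if l = m then cinner z (f m) else 0)"
        by (intro sum.cong refl) (use that in \<open>auto simp: ortho\<close>)
      then show ?thesis
        using that by (simp add: w_def cinner.diff_left cinner.sum_left cinner.scaleC_left)
    qed
    then have "P f n ((1 / norm w) *\<^sub>R w)"
      using \<open>w \<noteq> 0\<close> by (simp add: P_def cinner.scaleR_left)
    then show "\<exists>r. P f n r" ..
  qed (simp add: P_def)
  then obtain f where f: "\<And>n. P f n (f n)" by blast
  have "cinner (f l) (f m) = (if l = m then 1 else 0)" for l m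
    using f[of l] f[of m] cinner_commute[of "f l" "f m"]
    by (cases l m rule: linorder_cases) (auto simp: P_def cinner_self)
  then show thesis by (intro that[of f]) (simp add: orthonormal_def)
qed

section \<open>Sums over words and the defect form of a row contraction\<close>

lemma finite_words [simp]: "finite {\<alpha> :: 'n::finite list. length \<alpha> = k}"
  using finite_lists_length_eq[of "UNIV :: 'n set" k] by simp

lemma words_less_eq_Union: "{\<alpha> :: 'n list. length \<alpha> < k} = (\<Union>j<k. {\<alpha>. length \<alpha> = j})"
  by auto

lemma finite_words_less [simp]: "finite {\<alpha> :: 'n::finite list. length \<alpha> < k}"
  by (simp add: words_less_eq_Union)

lemma sum_words_less:
  "(\<Sum>\<alpha> :: 'n::finite list | length \<alpha> < k. F \<alpha>) = (\<Sum>j<k. \<Sum>\<alpha> | length \<alpha> = j. F \<alpha>)"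
  unfolding words_less_eq_Union by (rule sum.UNION_disjoint) auto

lemma sum_words_Suc:
  "(\<Sum>\<alpha> :: 'n::finite list | length \<alpha> = Suc k. F \<alpha>) = (\<Sum>i\<in>UNIV. \<Sum>\<alpha> | length \<alpha> = k. F (i # \<alpha>))"
proof -
  have "{\<alpha> :: 'n list. length \<alpha> = Suc k} = (\<lambda>(i, \<alpha>). i # \<alpha>) ` (UNIV \<times> {\<alpha>. length \<alpha> = k})"
    by (auto simp: length_Suc_conv image_iff)
  then have "(\<Sum>\<alpha> :: 'n list | length \<alpha> = Suc k. F \<alpha>)
      = (\<Sum>(i, \<alpha>)\<in>UNIV \<times> {\<alpha>. length \<alpha> = k}. F (i # \<alpha>))"
    by (simp add: sum.reindex inj_on_def case_prod_unfold)
  then show ?thesis by (simp add: sum.cartesian_product)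
qed

lemma sum_words_less_Suc:
  "(\<Sum>\<alpha> :: 'n::finite list | length \<alpha> < Suc k. F \<alpha>)
    = F [] + (\<Sum>i\<in>UNIV. \<Sum>\<alpha> | length \<alpha> < k. F (i # \<alpha>))"
proof -
  have "(\<Sum>i\<in>UNIV. \<Sum>\<alpha> | length \<alpha> < k. F (i # \<alpha>)) = (\<Sum>j<k. \<Sum>i\<in>UNIV. \<Sum>\<alpha> | length \<alpha> = j. F (i # \<alpha>))"
    unfolding sum_words_less by (rule sum.swap)
  then show ?thesis
    unfolding sum_words_less sum.lessThan_Suc_shift sum_words_Suc by simp
qed

text \<open>When the \<open>T i\<close> are the adjoints of a row contraction, this is the form of
  the square of its defect operator.\<close>

definition defect_form ::
    "('n::finite \<Rightarrow> 'a \<Rightarrow> 'a) \<Rightarrow> 'a::complex_hilbert_space \<Rightarrow> 'a \<Rightarrow> complex" where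
  "defect_form T x y = cinner x y - (\<Sum>i\<in>UNIV. cinner (T i x) (T i y))"

lemma positive_form_defect_form:
  fixes T :: "'n::finite \<Rightarrow> 'a::complex_hilbert_space \<Rightarrow> 'a"
  assumes "\<And>i x y. T i (x + y) = T i x + T i y" "\<And>i c x. T i (c *\<^sub>C x) = c *\<^sub>C T i x"
    and "\<And>x. (\<Sum>i\<in>UNIV. (norm (T i x))\<^sup>2) \<le> (norm x)\<^sup>2"
  shows "positive_form (defect_form T)"
proof
  show "defect_form T x y = cnj (defect_form T y x)" for x y
    unfolding defect_form_def by (simp flip: cinner_commute)
qed (use assms in \<open>auto simp: defect_form_def cinner.add_left cinner.scaleC_left sum.distrib
    sum_distrib_left algebra_simps cinner_self\<close>)

text \<open>Splitting off the first letter applies the induction hypothesis to \<open>T i h\<close>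
  and \<open>T i k\<close>. The inner products of these vectors cancel against the sum subtracted in
  the term of the empty word.\<close>

lemma sum_defect_form:
  "(\<Sum>\<alpha> | length \<alpha> < m. defect_form T (fold T \<alpha> h) (fold T \<alpha> k))
    = cinner h k - (\<Sum>\<alpha> | length \<alpha> = m. cinner (fold T \<alpha> h) (fold T \<alpha> k))"
proof (induction m arbitrary: h k)
  case (Suc m)
  show ?case
    by (simp add: sum_words_less_Suc sum_words_Suc Suc.IH sum_subtractf) (simp add: defect_form_def)
qed simp

lemma sum_norm_fold_le:
  fixes T :: "'n::finite \<Rightarrow> 'a::complex_hilbert_space \<Rightarrow> 'a"
  assumes "\<And>x. (\<Sum>i\<in>UNIV. (norm (T i x))\<^sup>2) \<le> \<rho> * (norm x)\<^sup>2" and "0 \<le> \<rho>"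
  shows "(\<Sum>\<alpha> | length \<alpha> = m. (norm (fold T \<alpha> h))\<^sup>2) \<le> \<rho> ^ m * (norm h)\<^sup>2"
proof (induction m arbitrary: h)
  case (Suc m)
  have "(\<Sum>\<alpha> | length \<alpha> = Suc m. (norm (fold T \<alpha> h))\<^sup>2) \<le> (\<Sum>i\<in>UNIV. \<rho> ^ m * (norm (T i h))\<^sup>2)"
    unfolding sum_words_Suc by (rule sum_mono) (simp add: Suc.IH)
  also have "\<dots> \<le> \<rho> ^ m * (\<rho> * (norm h)\<^sup>2)"
    unfolding sum_distrib_left[symmetric] by (intro mult_left_mono assms zero_le_power)
  finally show ?case by (simp add: mult_ac)
qed simp

text \<open>Bounds the remainder in \<open>sum_defect_form\<close>, which therefore decays
  geometrically for \<open>\<rho> < 1\<close>. Each letter contributes one factor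
  \<open>\<rho>\<close>, by \<open>sum_norm_fold_le\<close>.\<close>

lemma sum_cinner_fold_le:
  fixes T :: "'n::finite \<Rightarrow> 'a::complex_hilbert_space \<Rightarrow> 'a"
  assumes "\<And>x. (\<Sum>i\<in>UNIV. (norm (T i x))\<^sup>2) \<le> \<rho> * (norm x)\<^sup>2" and "0 \<le> \<rho>"
  shows "cmod (\<Sum>\<alpha> | length \<alpha> = m. cinner (fold T \<alpha> h) (fold T \<alpha> k)) \<le> \<rho> ^ m * (norm h * norm k)"
proof -
  let ?W = "{\<alpha> :: 'n list. length \<alpha> = m}"
  have L2: "L2_set (\<lambda>\<alpha>. norm (fold T \<alpha> x)) ?W \<le> sqrt (\<rho> ^ m) * norm x" for x
    unfolding L2_set_def
    using real_sqrt_le_mono[OF sum_norm_fold_le[of T \<rho>, OF assms, where m = m and h = x]]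
    by (simp add: real_sqrt_mult)
  have "cmod (\<Sum>\<alpha>\<in>?W. cinner (fold T \<alpha> h) (fold T \<alpha> k))
      \<le> (\<Sum>\<alpha>\<in>?W. \<bar>norm (fold T \<alpha> h)\<bar> * \<bar>norm (fold T \<alpha> k)\<bar>)"
    by (rule order_trans[OF norm_sum]) (auto intro!: sum_mono norm_cinner_le)
  also have "\<dots> \<le> L2_set (\<lambda>\<alpha>. norm (fold T \<alpha> h)) ?W * L2_set (\<lambda>\<alpha>. norm (fold T \<alpha> k)) ?W"
    by (rule L2_set_mult_ineq)
  also have "\<dots> \<le> (sqrt (\<rho> ^ m) * norm h) * (sqrt (\<rho> ^ m) * norm k)"
    by (intro mult_mono L2 L2_set_nonneg) (simp add: assms(2))
  also have "\<dots> = (sqrt (\<rho> ^ m) * sqrt (\<rho> ^ m)) * (norm h * norm k)"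
    by (simp only: mult_ac)
  finally show ?thesis using assms(2) by simp
qed

text \<open>The first letter is outermost in \<open>word_op\<close>, so its adjoint acts first on
  \<open>k\<close>; this is the order of \<open>fold\<close>.\<close>

lemma cinner_word_op:
  assumes "Z \<in> operator_tuples"
  shows "cinner (blinfun_apply (word_op Z \<beta>) h) k
    = cinner h (fold (\<lambda>i. blinfun_apply (adjoint_op (Z $ i))) \<beta> k)"
  using assms
  by (induction \<beta> arbitrary: k) (auto simp: word_op_def cinner_adjoint_op operator_tuples_def)

lemma word_op_orthonormal:
  assumes "\<And>i \<alpha>. blinfun_apply (X $ i) (e \<alpha>) = e (i # \<alpha>)"
  shows "blinfun_apply (word_op X \<beta>) (e \<alpha>) = e (\<beta> @ \<alpha>)"
  using assms by (induction \<beta>) (auto simp: word_op_def)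

lemma word_op_mem: "X \<in> operator_tuples \<Longrightarrow> word_op X \<beta> \<in> bounded_operators"
  by (induction \<beta>) (auto simp: word_op_def bounded_operators_def operator_tuples_def)

lemma word_op_scaleR: "word_op (r *\<^sub>R X) \<beta> = r ^ length \<beta> *\<^sub>R word_op X \<beta>"
proof (induction \<beta>)
  case (Cons i \<beta>)
  have "word_op (r *\<^sub>R X) (i # \<beta>) = (r *\<^sub>R (X $ i)) o\<^sub>L word_op (r *\<^sub>R X) \<beta>"
    by (simp add: word_op_def)
  also have "\<dots> = r ^ length (i # \<beta>) *\<^sub>R word_op X (i # \<beta>)"
    unfolding Cons.IH
    by (intro blinfun_eqI) (simp add: word_op_def blinfun.scaleR_left blinfun.scaleR_right)
  finally show ?case .
qed (simp add: word_op_def)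

section \<open>Noncommutative polynomials and their comparison with creation operators\<close>

lemma scaleC_blinfun_apply: "blinfun_apply (scaleC_blinfun c A) x = c *\<^sub>C blinfun_apply A x"
  by transfer rule

text \<open>The length bound is strict so that the value is exactly the \<open>N\<close>-th partial
  sum in the sense of \<open>sums\<close>.\<close>

definition nc_poly :: "nat \<Rightarrow> ('n list \<Rightarrow> complex) \<Rightarrow>
    ('a::complex_hilbert_space \<Rightarrow>\<^sub>L 'a) ^ 'n::finite \<Rightarrow> ('a \<Rightarrow>\<^sub>L 'a)" where
  "nc_poly N a X = (\<Sum>\<beta> | length \<beta> < N. scaleC_blinfun (a \<beta>) (word_op X \<beta>))"

lemma nc_poly_apply:
  "blinfun_apply (nc_poly N a X) x = (\<Sum>\<beta> | length \<beta> < N. a \<beta> *\<^sub>C blinfun_apply (word_op X \<beta>) x)"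
  by (simp add: nc_poly_def blinfun.sum_left scaleC_blinfun_apply)

text \<open>A dilation of the tuple can be absorbed into the coefficients, so an inequality for all
  polynomials also compares dilated tuples.\<close>

lemma nc_poly_scaleR: "nc_poly N a (r *\<^sub>R X) = nc_poly N (\<lambda>\<alpha>. of_real (r ^ length \<alpha>) * a \<alpha>) X"
  by (intro blinfun_eqI)
    (simp add: nc_poly_apply word_op_scaleR blinfun.scaleR_left scaleR_scaleC scaleC_scaleC mult.commute)

text \<open>Telescoping pairs \<open>fold T \<alpha> h\<close> with
  \<open>fold T \<alpha> (fold T \<beta> k)\<close>, which is
  \<open>fold T (\<beta> @ \<alpha>) k\<close>; \<open>X\<close> acts on \<open>e\<close> by the
  same concatenation. The two polynomials thus share one coefficient matrix, to which
  \<open>bilinear_bound\<close> applies. Strictness of the row contraction makes the remainder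
  vanish in the limit.\<close>

lemma von_Neumann_inequality:
  fixes Z X :: "('a::complex_hilbert_space \<Rightarrow>\<^sub>L 'a) ^ 'n::finite" and e :: "'n list \<Rightarrow> 'a"
  assumes Z: "Z \<in> open_row_ball" and X: "X \<in> operator_tuples" and e: "orthonormal e"
    and shift: "\<And>i \<alpha>. blinfun_apply (X $ i) (e \<alpha>) = e (i # \<alpha>)"
  shows "norm (nc_poly N a Z) \<le> norm (nc_poly N a X)"
proof -
  define T where "T i = blinfun_apply (adjoint_op (Z $ i))" for i
  define \<rho> where "\<rho> = (row_norm Z)\<^sup>2"
  define M where "M = norm (nc_poly N a X)"
  let ?W = "{\<beta> :: 'n list. length \<beta> < N}"
  have Zt: "Z \<in> operator_tuples" and "row_norm Z < 1" using Z by (auto simp: open_row_ball_def)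
  moreover have "0 \<le> row_norm Z" by (simp add: row_norm_def)
  ultimately have \<rho>: "0 \<le> \<rho>" "\<rho> < 1" by (auto simp: \<rho>_def power_less_one_iff)
  have T: "(\<Sum>i\<in>UNIV. (norm (T i x))\<^sup>2) \<le> \<rho> * (norm x)\<^sup>2" for x
    unfolding T_def \<rho>_def by (rule sum_norm_adjoint_le[OF Zt])
  have T1: "(\<Sum>i\<in>UNIV. (norm (T i x))\<^sup>2) \<le> (norm x)\<^sup>2" for x
    using T[of x] mult_right_mono[of \<rho> 1 "(norm x)\<^sup>2"] \<rho> by simp
  interpret D: positive_form "defect_form T"
    by (rule positive_form_defect_form[OF _ _ T1])
      (use Zt in \<open>auto simp: T_def blinfun.add_right operator_tuples_def
        bounded_operators_scaleC[OF adjoint_op_mem]\<close>)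
  have D_sum: "(\<Sum>\<alpha> | length \<alpha> < m. Re (defect_form T (fold T \<alpha> h) (fold T \<alpha> h))) \<le> (norm h)\<^sup>2" for m h
  proof -
    have "(\<Sum>\<alpha> | length \<alpha> < m. Re (defect_form T (fold T \<alpha> h) (fold T \<alpha> h)))
        = Re (\<Sum>\<alpha> | length \<alpha> < m. defect_form T (fold T \<alpha> h) (fold T \<alpha> h))" by simp
    also have "\<dots> = (norm h)\<^sup>2 - (\<Sum>\<alpha> | length \<alpha> = m. (norm (fold T \<alpha> h))\<^sup>2)"
      unfolding sum_defect_form by (simp add: cinner_self)
    also have "\<dots> \<le> (norm h)\<^sup>2" by (simp add: sum_nonneg)
    finally show ?thesis .
  qed
  define R where "R m h k = (\<Sum>\<alpha> | length \<alpha> = m. cinner (fold T \<alpha> h) (fold T \<alpha> k))" for m h k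
  have R_lim: "(\<lambda>m. R m h k) \<longlonglongrightarrow> 0" for h k
  proof (rule Lim_null_comparison)
    show "\<forall>\<^sub>F m in sequentially. norm (R m h k) \<le> \<rho> ^ m * (norm h * norm k)"
      unfolding R_def by (intro always_eventually allI sum_cinner_fold_le T \<rho>)
    show "(\<lambda>m. \<rho> ^ m * (norm h * norm k)) \<longlonglongrightarrow> 0"
      using \<rho> by (intro tendsto_mult_left_zero LIMSEQ_power_zero) auto
  qed
  \<comment> \<open>Telescoping stops at words of length \<open>m\<close>, which leaves the error
    terms \<open>R m\<close>; the bound does not depend on \<open>m\<close>.\<close>
  have truncated: "cmod (cinner (blinfun_apply (nc_poly N a Z) h) k - (\<Sum>\<beta>\<in>?W. a \<beta> * R m h (fold T \<beta> k)))
      \<le> M * norm h * norm k" for m h k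
  proof -
    let ?I = "{\<alpha> :: 'n list. length \<alpha> < m}"
    \<comment> \<open>Long enough to contain every \<open>\<beta> @ \<alpha>\<close> with
      \<open>\<beta>\<close> in \<open>?W\<close> and \<open>\<alpha>\<close> in
      \<open>?I\<close>.\<close>
    let ?J = "{\<gamma> :: 'n list. length \<gamma> < N + m}"
    \<comment> \<open>The entry \<open>cinner (nc_poly N a X (e \<alpha>)) (e \<gamma>)\<close>. At
      most one \<open>\<beta>\<close> contributes, as it is determined by \<open>\<alpha>\<close>
      and \<open>\<gamma>\<close>.\<close>
    define b where "b \<alpha> \<gamma> = (\<Sum>\<beta>\<in>?W. if \<beta> @ \<alpha> = \<gamma> then a \<beta> else 0)" for \<alpha> \<gamma>
    have b: "(\<Sum>\<gamma>\<in>?J. b \<alpha> \<gamma> * G \<gamma>) = (\<Sum>\<beta>\<in>?W. a \<beta> * G (\<beta> @ \<alpha>))" if "\<alpha> \<in> ?I" for \<alpha> and G :: "'n list \<Rightarrow> complex"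
    proof -
      have "(\<Sum>\<gamma>\<in>?J. b \<alpha> \<gamma> * G \<gamma>) = (\<Sum>\<gamma>\<in>?J. \<Sum>\<beta>\<in>?W. if \<beta> @ \<alpha> = \<gamma> then a \<beta> * G \<gamma> else 0)"
        by (auto simp: b_def sum_distrib_right intro!: sum.cong)
      also have "\<dots> = (\<Sum>\<beta>\<in>?W. \<Sum>\<gamma>\<in>?J. if \<beta> @ \<alpha> = \<gamma> then a \<beta> * G \<gamma> else 0)"
        by (rule sum.swap)
      also have "\<dots> = (\<Sum>\<beta>\<in>?W. a \<beta> * G (\<beta> @ \<alpha>))"
        by (intro sum.cong refl) (use that in \<open>simp add: sum.delta\<close>)
      finally show ?thesis .
    qed
    \<comment> \<open>The double sum is the pairing of \<open>nc_poly N a X\<close> at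
      \<open>x\<close> with \<open>y\<close>, where \<open>c\<close> and \<open>d\<close> are the
      coordinates of \<open>x\<close> and \<open>y\<close> along \<open>e\<close>.\<close>
    have "cmod (\<Sum>\<alpha>\<in>?I. \<Sum>\<gamma>\<in>?J. b \<alpha> \<gamma> * (c \<alpha> * cnj (d \<gamma>)))
      \<le> M * (L2_set (\<lambda>\<alpha>. cmod (c \<alpha>)) ?I * L2_set (\<lambda>\<gamma>. cmod (d \<gamma>)) ?J)" for c d
    proof -
      define x where "x = (\<Sum>\<alpha>\<in>?I. c \<alpha> *\<^sub>C e \<alpha>)"
      define y where "y = (\<Sum>\<gamma>\<in>?J. d \<gamma> *\<^sub>C e \<gamma>)"
      have ey: "cinner (e \<delta>) y = cnj (d \<delta>)" if "\<delta> \<in> ?J" for \<delta>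
      proof -
        have "cinner (e \<delta>) y = (\<Sum>\<gamma>\<in>?J. if \<gamma> = \<delta> then cnj (d \<delta>) else 0)"
          unfolding y_def cinner.sum_right
          by (intro sum.cong refl) (use e in \<open>auto simp: cinner.scaleC_right orthonormal_def\<close>)
        then show ?thesis using that by simp
      qed
      have "cinner (blinfun_apply (nc_poly N a X) x) y
          = (\<Sum>\<alpha>\<in>?I. \<Sum>\<beta>\<in>?W. a \<beta> * (c \<alpha> * cinner (e (\<beta> @ \<alpha>)) y))"
        unfolding x_def
        by (simp add: blinfun.sum_right bounded_operators_scaleC[OF word_op_mem[OF X]] nc_poly_apply
            word_op_orthonormal[OF shift] cinner.sum_left cinner.scaleC_left sum_distrib_left mult_ac)
      also have "\<dots> = (\<Sum>\<alpha>\<in>?I. \<Sum>\<gamma>\<in>?J. b \<alpha> \<gamma> * (c \<alpha> * cnj (d \<gamma>)))"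
      proof (rule sum.cong[OF refl])
        fix \<alpha> assume \<alpha>: "\<alpha> \<in> ?I"
        show "(\<Sum>\<beta>\<in>?W. a \<beta> * (c \<alpha> * cinner (e (\<beta> @ \<alpha>)) y)) = (\<Sum>\<gamma>\<in>?J. b \<alpha> \<gamma> * (c \<alpha> * cnj (d \<gamma>)))"
          unfolding b[OF \<alpha>] by (rule sum.cong[OF refl]) (use \<alpha> in \<open>simp add: ey\<close>)
      qed
      finally have "cmod (\<Sum>\<alpha>\<in>?I. \<Sum>\<gamma>\<in>?J. b \<alpha> \<gamma> * (c \<alpha> * cnj (d \<gamma>)))
          = cmod (cinner (blinfun_apply (nc_poly N a X) x) y)" by simp
      also have "\<dots> \<le> M * norm x * norm y"
        unfolding M_def
        by (rule order_trans[OF norm_cinner_le]) (intro mult_right_mono norm_blinfun norm_ge_zero)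
      finally show ?thesis by (simp add: x_def y_def norm_sum_orthonormal[OF e] mult.assoc)
    qed
    then have "cmod (\<Sum>\<alpha>\<in>?I. \<Sum>\<gamma>\<in>?J. b \<alpha> \<gamma> * defect_form T (fold T \<alpha> h) (fold T \<gamma> k))
      \<le> M * (sqrt (\<Sum>\<alpha>\<in>?I. Re (defect_form T (fold T \<alpha> h) (fold T \<alpha> h)))
          * sqrt (\<Sum>\<gamma>\<in>?J. Re (defect_form T (fold T \<gamma> k) (fold T \<gamma> k))))"
      by (intro D.bilinear_bound) (auto simp: M_def)
    also have "\<dots> \<le> M * (norm h * norm k)"
      by (intro mult_left_mono mult_mono real_le_lsqrt D_sum real_sqrt_ge_zero sum_nonneg D.ge_zero norm_ge_zero)
        (simp add: M_def)
    \<comment> \<open>The sum over \<open>\<gamma>\<close> collapses to the words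
      \<open>\<beta> @ \<alpha>\<close>, after which the sum over \<open>\<alpha>\<close> telescopes
      for each fixed \<open>\<beta>\<close>.\<close>
    also have "(\<Sum>\<alpha>\<in>?I. \<Sum>\<gamma>\<in>?J. b \<alpha> \<gamma> * defect_form T (fold T \<alpha> h) (fold T \<gamma> k))
        = (\<Sum>\<alpha>\<in>?I. \<Sum>\<beta>\<in>?W. a \<beta> * defect_form T (fold T \<alpha> h) (fold T \<alpha> (fold T \<beta> k)))"
      by (rule sum.cong[OF refl]) (simp add: b)
    also have "\<dots> = (\<Sum>\<beta>\<in>?W. a \<beta> * (\<Sum>\<alpha>\<in>?I. defect_form T (fold T \<alpha> h) (fold T \<alpha> (fold T \<beta> k))))"
      unfolding sum_distrib_left by (rule sum.swap)
    also have "\<dots> = (\<Sum>\<beta>\<in>?W. a \<beta> * cinner h (fold T \<beta> k)) - (\<Sum>\<beta>\<in>?W. a \<beta> * R m h (fold T \<beta> k))"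
      by (simp add: sum_defect_form R_def right_diff_distrib sum_subtractf)
    also have "(\<Sum>\<beta>\<in>?W. a \<beta> * cinner h (fold T \<beta> k)) = cinner (blinfun_apply (nc_poly N a Z) h) k"
      by (simp add: nc_poly_apply cinner.sum_left cinner.scaleC_left cinner_word_op[OF Zt] T_def[abs_def])
    finally show ?thesis by (simp add: mult.assoc)
  qed
  have "cmod (cinner (blinfun_apply (nc_poly N a Z) h) k) \<le> M * norm h * norm k" for h k
  proof (rule tendsto_upperbound)
    show "(\<lambda>m. cmod (cinner (blinfun_apply (nc_poly N a Z) h) k - (\<Sum>\<beta>\<in>?W. a \<beta> * R m h (fold T \<beta> k))))
        \<longlonglongrightarrow> cmod (cinner (blinfun_apply (nc_poly N a Z) h) k)"
      by (rule tendsto_eq_intros R_lim refl)+ simp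
  qed (use truncated in auto)
  then show ?thesis
    unfolding M_def[symmetric]
    by (intro norm_blinfun_bound norm_le_if_cinner_le) (auto simp: M_def)
qed

section \<open>From polynomials on the open ball to boundary values\<close>

theorem theorem3p3:
  fixes f :: "('h::complex_hilbert_space \<Rightarrow>\<^sub>L 'h) ^ 'n::finite \<Rightarrow> ('h \<Rightarrow>\<^sub>L 'h)"
  assumes infinite_dimensional:
      "\<not> (\<exists>B :: 'h set. finite B \<and> complex_vector.span B = UNIV)"
    and maps_to: "\<forall>X \<in> closed_row_ball. f X \<in> bounded_operators"
    and continuous: "continuous_on closed_row_ball f"
    and holomorphic: "free_holomorphic f"
  shows "\<exists>m. is_maximum {norm (f X) | X. X \<in> closed_row_ball} m \<and>
             is_maximum {norm (f X) | X. X \<in> row_sphere} m"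
proof -
  obtain e\<^sub>0 :: "nat \<Rightarrow> 'h" where "orthonormal e\<^sub>0"
    using orthonormal_sequence_exists[OF infinite_dimensional] .
  \<comment> \<open>Words over a finite alphabet are countable, so \<open>to_nat\<close> indexes
    them injectively by naturals.\<close>
  then have e: "orthonormal (\<lambda>\<alpha> :: 'n list. e\<^sub>0 (to_nat \<alpha>))"
    by (rule orthonormal_compose) simp
  obtain X :: "('h \<Rightarrow>\<^sub>L 'h) ^ 'n" where sphere: "X \<in> row_sphere"
    and shift: "\<And>i \<alpha>. blinfun_apply (X $ i) (e\<^sub>0 (to_nat \<alpha>)) = e\<^sub>0 (to_nat (i # \<alpha>))"
    by (rule creation_operators[OF e]) blast
  obtain a :: "'n list \<Rightarrow> complex" where
    a: "\<And>Y. Y \<in> open_row_ball \<Longrightarrow>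
      (\<lambda>k. \<Sum>\<alpha> | length \<alpha> = k. scaleC_blinfun (a \<alpha>) (word_op Y \<alpha>)) sums f Y"
    using holomorphic unfolding free_holomorphic_def by blast
  have lim: "(\<lambda>N. nc_poly N a Y) \<longlonglongrightarrow> f Y" if "Y \<in> open_row_ball" for Y
    using a[OF that] by (simp add: sums_def nc_poly_def sum_words_less)
  have ball: "X \<in> closed_row_ball" using sphere by (auto simp: row_sphere_def closed_row_ball_def)
  have shrink: "r *\<^sub>R Y \<in> open_row_ball" if "Y \<in> closed_row_ball" "0 \<le> r" "r < 1" for Y :: "('h \<Rightarrow>\<^sub>L 'h) ^ 'n" and r
  proof -
    have "r * row_norm Y \<le> r * 1"
      using that by (intro mult_left_mono) (auto simp: closed_row_ball_def)
    then show ?thesis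
      using that by (auto simp: closed_row_ball_def open_row_ball_def operator_tuples_scaleR row_norm_scaleR)
  qed
  \<comment> \<open>The values start at \<open>s 0 = 0\<close> and stay below 1, as
    \<open>shrink\<close> requires.\<close>
  define s where "s n = 1 - inverse (real (Suc n))" for n
  have s: "0 \<le> s n" "s n < 1" for n by (auto simp: s_def field_simps)
  have s_lim: "s \<longlonglongrightarrow> 1"
    unfolding s_def using tendsto_diff[OF tendsto_const LIMSEQ_inverse_real_of_nat, of 1] by simp
  have radial: "(\<lambda>n. f (r n *\<^sub>R Y)) \<longlonglongrightarrow> f Y"
    if "Y \<in> closed_row_ball" "r \<longlonglongrightarrow> 1" "\<And>n. 0 \<le> r n" "\<And>n. r n < 1" for r Y
  proof (rule continuous_on_tendsto_compose[OF continuous _ that(1)])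
    show "(\<lambda>n. r n *\<^sub>R Y) \<longlonglongrightarrow> Y" using tendsto_scaleR[OF that(2) tendsto_const, of Y] by simp
    show "\<forall>\<^sub>F n in sequentially. r n *\<^sub>R Y \<in> closed_row_ball"
      using shrink[OF that(1) that(3,4)]
      by (intro always_eventually) (auto simp: open_row_ball_def closed_row_ball_def less_imp_le)
  qed
  \<comment> \<open>Two factors \<open>s n\<close> act on \<open>Y\<close>: one makes it a strict
    row contraction for the von Neumann inequality; the other is shared with \<open>X\<close>,
    moving it into the open ball where the series converges.\<close>
  have "norm (f Y) \<le> norm (f X)" if Y: "Y \<in> closed_row_ball" for Y
  proof (rule LIMSEQ_le)
    show "(\<lambda>n. norm (f ((s n * s n) *\<^sub>R Y))) \<longlonglongrightarrow> norm (f Y)"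
    proof (intro tendsto_norm radial Y)
      show "(\<lambda>n. s n * s n) \<longlonglongrightarrow> 1" using tendsto_mult[OF s_lim s_lim] by simp
      show "s n * s n < 1" for n using s[of n] mult_strict_mono[of "s n" 1 "s n" 1] by simp
    qed (simp add: s)
    show "(\<lambda>n. norm (f (s n *\<^sub>R X))) \<longlonglongrightarrow> norm (f X)"
      by (intro tendsto_norm radial ball s_lim s)
    have "norm (f ((s n * s n) *\<^sub>R Y)) \<le> norm (f (s n *\<^sub>R X))" for n
    proof (rule LIMSEQ_le)
      have "s n *\<^sub>R (s n *\<^sub>R Y) \<in> open_row_ball"
      proof (rule shrink[OF _ s])
        show "s n *\<^sub>R Y \<in> closed_row_ball"
          using shrink[OF Y s, of n] by (auto simp: open_row_ball_def closed_row_ball_def)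
      qed
      then show "(\<lambda>N. norm (nc_poly N a (s n *\<^sub>R (s n *\<^sub>R Y)))) \<longlonglongrightarrow> norm (f ((s n * s n) *\<^sub>R Y))"
        using lim by (intro tendsto_norm) fastforce
      show "(\<lambda>N. norm (nc_poly N a (s n *\<^sub>R X))) \<longlonglongrightarrow> norm (f (s n *\<^sub>R X))"
        by (intro tendsto_norm lim shrink ball s)
      have "norm (nc_poly N a (s n *\<^sub>R (s n *\<^sub>R Y))) \<le> norm (nc_poly N a (s n *\<^sub>R X))" for N
        \<comment> \<open>Fixing the coefficients \<open>a\<close> absorbs only the outer factor, so
          \<open>s n *\<^sub>R Y\<close> is compared with the undilated \<open>X\<close>.\<close>
        unfolding nc_poly_scaleR[of N a "s n"]
        by (rule von_Neumann_inequality[OF shrink[OF Y s] _ e shift])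
          (use sphere in \<open>simp add: row_sphere_def\<close>)
      then show "\<exists>M. \<forall>N\<ge>M. norm (nc_poly N a (s n *\<^sub>R (s n *\<^sub>R Y))) \<le> norm (nc_poly N a (s n *\<^sub>R X))"
        by blast
    qed
    then show "\<exists>M. \<forall>n\<ge>M. norm (f ((s n * s n) *\<^sub>R Y)) \<le> norm (f (s n *\<^sub>R X))" by blast
  qed
  then show ?thesis
    using sphere ball unfolding is_maximum_def
    by (intro exI[of _ "norm (f X)"]) (auto simp: row_sphere_def closed_row_ball_def)
qed

end
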